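(* Let $l,r\ge 0$ be integers and let $S$ be the $(p,m,1)$ signed graph consisting of a negative edge, to which are attached $l$ positive pendant edges at one end and $r$ positive pendant edges at the other. Then $S$ is additively graceful if and only if either $l=0$ or $r=0$.
   Context: A signed graph $S$ is a finite simple graph on $p$ vertices in which $m$ edges are specified as positive and the remaining $n$ edges are specified as negative; it is then called a $(p,m,n)$ signed graph, with sets of positive and negative edges $E^+(S)$ and $E^-(S)$. Attaching a pendant edge at a vertex $z$ means adding a new vertex of degree 1 joined to $z$. Thus $S$ has a negative edge $z_1z_2$ and positive edges $z_1v_i$ ($1\le i\le l$) and $z_2w_i$ ($1\le i\le r$), all these vertices being distinct, and no other vertices or edges. An additively graceful labeling of a $(p,m,n)$ signed graph $S=(V,E)$ is an injective map $f:V\to\{0,1,\dots,m+\lceil\frac{n+1}{2}\rceil\}$ such that, with $f^*(uv)=f(u)+f(v)$ for $uv\in E^-(S)$ and $f^*(uv)=|f(u)-f(v)|$ for $uv\in E^+(S)$, one has $\{f^*(uv):uv\in E^-(S)\}=\{1,2,\dots,n\}$ and $\{f^*(uv):uv\in E^+(S)\}=\{1,2,\dots,m\}$. $S$ is additively graceful if it admits such a labeling. *)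

theory Defs
  imports Complex_Main
begin

record 'a sgraph =
  verts :: "'a set"
  pos_edges :: "'a set set"
  neg_edges :: "'a set set"

definition signed_graph :: "nat \<Rightarrow> nat \<Rightarrow> nat \<Rightarrow> 'a sgraph \<Rightarrow> bool" where
  "signed_graph p m n S \<longleftrightarrow>
     finite (verts S) \<and> card (verts S) = p \<and>
     (\<forall>e \<in> pos_edges S \<union> neg_edges S. e \<subseteq> verts S \<and> card e = 2) \<and>
     pos_edges S \<inter> neg_edges S = {} \<and>
     card (pos_edges S) = m \<and> card (neg_edges S) = n"

text \<open>The values of a labeling are constrained on the vertices only; outside of
  \<open>verts S\<close> the function is arbitrary. The difference is taken in \<open>int\<close>
  because subtraction on \<open>nat\<close> truncates.\<close>

definition additively_graceful_labeling :: "'a sgraph \<Rightarrow> ('a \<Rightarrow> nat) \<Rightarrow> bool" where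
  "additively_graceful_labeling S f \<longleftrightarrow>
     (let m = card (pos_edges S); n = card (neg_edges S) in
        inj_on f (verts S) \<and>
        f ` verts S \<subseteq> {0..m + nat \<lceil>(real n + 1) / 2\<rceil>} \<and>
        {f u + f v | u v. {u, v} \<in> neg_edges S} = {1..n} \<and>
        {\<bar>int (f u) - int (f v)\<bar> | u v. {u, v} \<in> pos_edges S} = {1..int m})"

definition additively_graceful :: "'a sgraph \<Rightarrow> bool" where
  "additively_graceful S \<longleftrightarrow> (\<exists>f. additively_graceful_labeling S f)"

text \<open>A negative edge \<open>z1 z2\<close> with \<open>l\<close> positive pendant edges \<open>z1 (v i)\<close> and
  \<open>r\<close> positive pendant edges \<open>z2 (w i)\<close>. The predicate is closed under isomorphism.\<close>

definition neg_edge_with_pendants :: "nat \<Rightarrow> nat \<Rightarrow> 'a sgraph \<Rightarrow> bool" where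
  "neg_edge_with_pendants l r S \<longleftrightarrow>
     (\<exists>z1 z2 v w.
        z1 \<noteq> z2 \<and> inj_on v {1..l} \<and> inj_on w {1..r} \<and>
        v ` {1..l} \<inter> w ` {1..r} = {} \<and>
        {z1, z2} \<inter> (v ` {1..l} \<union> w ` {1..r}) = {} \<and>
        verts S = {z1, z2} \<union> v ` {1..l} \<union> w ` {1..r} \<and>
        pos_edges S = (\<lambda>i. {z1, v i}) ` {1..l} \<union> (\<lambda>i. {z2, w i}) ` {1..r} \<and>
        neg_edges S = {{z1, z2}})"

lemma neg_edge_with_pendants_signed_graph:
  assumes "neg_edge_with_pendants l r S"
  shows "signed_graph (l + r + 2) (l + r) 1 S"
proof -
  obtain z1 z2 v w where
    z: "z1 \<noteq> z2" and v: "inj_on v {1..l}" and w: "inj_on w {1..r}"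
    and vw: "v ` {1..l} \<inter> w ` {1..r} = {}"
    and zvw: "{z1, z2} \<inter> (v ` {1..l} \<union> w ` {1..r}) = {}"
    and V: "verts S = {z1, z2} \<union> (v ` {1..l} \<union> w ` {1..r})"
    and P: "pos_edges S = (\<lambda>i. {z1, v i}) ` {1..l} \<union> (\<lambda>i. {z2, w i}) ` {1..r}"
    and N: "neg_edges S = {{z1, z2}}"
    using assms unfolding neg_edge_with_pendants_def Un_assoc by (elim exE conjE)
  have v_ne: "v i \<noteq> z1" "v i \<noteq> z2" if "i \<in> {1..l}" for i using zvw that by blast+
  have w_ne: "w i \<noteq> z1" "w i \<noteq> z2" if "i \<in> {1..r}" for i using zvw that by blast+
  have "card (v ` {1..l} \<union> w ` {1..r}) = l + r"
    using v w vw by (simp add: card_Un_disjoint card_image)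
  then have cV: "card (verts S) = l + r + 2"
    unfolding V using z card_Un_disjoint[OF _ _ zvw] by simp
  have inj: "inj_on (\<lambda>i. {z1, v i}) {1..l}" "inj_on (\<lambda>i. {z2, w i}) {1..r}"
    by (rule inj_onI, use v in \<open>force simp: doubleton_eq_iff dest: inj_onD\<close>)
       (rule inj_onI, use w in \<open>force simp: doubleton_eq_iff dest: inj_onD\<close>)
  have ne: "{z1, v i} \<noteq> {z2, w j}" if "i \<in> {1..l}" "j \<in> {1..r}" for i j
    using z w_ne(1)[OF that(2)] by (simp add: doubleton_eq_iff)
  then have "(\<lambda>i. {z1, v i}) ` {1..l} \<inter> (\<lambda>i. {z2, w i}) ` {1..r} = {}" by blast
  then have cP: "card (pos_edges S) = l + r"
    unfolding P using inj by (simp add: card_Un_disjoint card_image)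
  have edges: "\<forall>e \<in> pos_edges S \<union> neg_edges S. e \<subseteq> verts S \<and> card e = 2"
  proof -
    have "{z1, z2} \<subseteq> verts S \<and> card {z1, z2} = 2" using z by (simp add: V)
    moreover have "{z1, v i} \<subseteq> verts S \<and> card {z1, v i} = 2" if "i \<in> {1..l}" for i
      using that v_ne(1)[OF that] unfolding V by (simp add: card_insert_if)
    moreover have "{z2, w i} \<subseteq> verts S \<and> card {z2, w i} = 2" if "i \<in> {1..r}" for i
      using that w_ne(2)[OF that] unfolding V by (simp add: card_insert_if)
    ultimately show ?thesis unfolding P N by blast
  qed
  have disj: "pos_edges S \<inter> neg_edges S = {}"
  proof -
    have "{z1, z2} \<noteq> {z1, v i}" if "i \<in> {1..l}" for i
      using v_ne[OF that] by (simp add: doubleton_eq_iff)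
    moreover have "{z1, z2} \<noteq> {z2, w i}" if "i \<in> {1..r}" for i
      using w_ne[OF that] by (simp add: doubleton_eq_iff)
    ultimately show ?thesis unfolding P N by blast
  qed
  show ?thesis
    unfolding signed_graph_def using cV cP edges disj by (simp add: V N)
qed

lemma neg_edge_with_pendants_exists: "\<exists>S :: nat sgraph. neg_edge_with_pendants l r S"
proof -
  let ?v = "\<lambda>i::nat. i + 1" and ?w = "\<lambda>i::nat. l + i + 1"
  let ?S = "\<lparr>verts = {0, 1} \<union> ?v ` {1..l} \<union> ?w ` {1..r},
     pos_edges = (\<lambda>i. {0, ?v i}) ` {1..l} \<union> (\<lambda>i. {1, ?w i}) ` {1..r},
     neg_edges = {{0, 1}}\<rparr> :: nat sgraph"
  have "(0::nat) \<noteq> 1" "inj_on ?v {1..l}" "inj_on ?w {1..r}" by (simp_all add: inj_on_def)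
  moreover have "?v ` {1..l} \<inter> ?w ` {1..r} = {}" by force
  moreover have "{0, 1} \<inter> (?v ` {1..l} \<union> ?w ` {1..r}) = {}" by force
  moreover have "verts ?S = {0, 1} \<union> ?v ` {1..l} \<union> ?w ` {1..r}" by (rule sgraph.select_convs)
  moreover have "pos_edges ?S = (\<lambda>i. {0, ?v i}) ` {1..l} \<union> (\<lambda>i. {1, ?w i}) ` {1..r}"
    by (rule sgraph.select_convs)
  moreover have "neg_edges ?S = {{0, 1}}" by (rule sgraph.select_convs)
  ultimately have "neg_edge_with_pendants l r ?S"
    unfolding neg_edge_with_pendants_def by (intro exI conjI)
  then show ?thesis by blast
qed

end

theory Submission
  imports Defs
begin

text \<open>Let \<open>m = l + r\<close>. With a single negative edge the labels range over \<open>{0..m + 1}\<close>, and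
  there are \<open>m + 2\<close> vertices, so a labeling uses every label exactly once; the ends of the
  negative edge, whose labels add up to \<open>1\<close>, get \<open>0\<close> and \<open>1\<close>, and the pendant vertices get
  \<open>2, \<dots>, m + 1\<close>. A pendant vertex labelled \<open>x\<close> gives its edge the label \<open>x\<close> if it hangs at the
  end labelled \<open>0\<close>, and \<open>x - 1\<close> if it hangs at the end labelled \<open>1\<close>. The numbers \<open>x - 1\<close> alone
  already run through \<open>1, \<dots>, m\<close>, and so must the edge labels. Since the edge labels dominate
  the numbers \<open>x - 1\<close> and have the same sum, the two agree at every pendant vertex, which means
  that nothing hangs at the end labelled \<open>0\<close> (lemma \<open>no_pendants_at_label_0\<close>). Conversely, if
  one end has no pendant vertices, labelling it \<open>0\<close>, the other end \<open>1\<close>, and the pendant vertices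
  \<open>2, \<dots>, m + 1\<close> in any order is additively graceful.\<close>

text \<open>Indexing the pendant vertices by sets rather than by numbers makes the two ends
  interchangeable.\<close>

definition neg_edge_double_star :: "'a sgraph \<Rightarrow> 'a \<Rightarrow> 'a \<Rightarrow> 'a set \<Rightarrow> 'a set \<Rightarrow> bool" where
  "neg_edge_double_star S a b A B \<longleftrightarrow>
     a \<noteq> b \<and> finite A \<and> finite B \<and> A \<inter> B = {} \<and> {a, b} \<inter> (A \<union> B) = {} \<and>
     verts S = {a, b} \<union> (A \<union> B) \<and>
     pos_edges S = (\<lambda>x. {a, x}) ` A \<union> (\<lambda>x. {b, x}) ` B \<and>
     neg_edges S = {{a, b}}"

lemma neg_edge_double_star_swap:
  "neg_edge_double_star S a b A B \<Longrightarrow> neg_edge_double_star S b a B A"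
  unfolding neg_edge_double_star_def
  by (intro conjI; elim conjE; simp add: insert_commute Un_commute Int_commute; blast)

lemma neg_edge_with_pendants_double_star:
  assumes "neg_edge_with_pendants l r S"
  obtains a b A B where "neg_edge_double_star S a b A B" "card A = l" "card B = r"
proof -
  obtain z1 z2 v w where
    "z1 \<noteq> z2" and v: "inj_on v {1..l}" and w: "inj_on w {1..r}"
    and "v ` {1..l} \<inter> w ` {1..r} = {}"
    and "{z1, z2} \<inter> (v ` {1..l} \<union> w ` {1..r}) = {}"
    and "verts S = {z1, z2} \<union> (v ` {1..l} \<union> w ` {1..r})"
    and "pos_edges S = (\<lambda>i. {z1, v i}) ` {1..l} \<union> (\<lambda>i. {z2, w i}) ` {1..r}"
    and "neg_edges S = {{z1, z2}}"
    using assms unfolding neg_edge_with_pendants_def Un_assoc by (elim exE conjE)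
  then have "neg_edge_double_star S z1 z2 (v ` {1..l}) (w ` {1..r})"
    unfolding neg_edge_double_star_def image_image by (intro conjI; simp)
  moreover have "card (v ` {1..l}) = l" "card (w ` {1..r}) = r"
    using v w by (simp_all add: card_image)
  ultimately show ?thesis by (rule that)
qed

lemma card_pos_edges_double_star:
  assumes "neg_edge_double_star S a b A B"
  shows "card (pos_edges S) = card (A \<union> B)"
proof -
  let ?e = "\<lambda>x. {if x \<in> A then a else b, x}"
  have "pos_edges S = ?e ` (A \<union> B)"
  proof -
    have "(\<lambda>x. {a, x}) ` A = ?e ` A"
      by (rule image_cong) simp_all
    moreover have "(\<lambda>x. {b, x}) ` B = ?e ` B"
      using assms unfolding neg_edge_double_star_def by (intro image_cong) auto
    ultimately show ?thesis
      using assms unfolding neg_edge_double_star_def image_Un by simp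
  qed
  moreover have "inj_on ?e (A \<union> B)"
    using assms unfolding neg_edge_double_star_def inj_on_def by (auto simp: doubleton_eq_iff)
  ultimately show ?thesis by (simp add: card_image)
qed

text \<open>Each edge is a doubleton and so matches \<open>{u, v}\<close> in two ways; for a symmetric
  edge function both ways give the same value.\<close>

lemma additively_graceful_labeling_double_star:
  assumes S: "neg_edge_double_star S a b A B"
  shows "additively_graceful_labeling S f \<longleftrightarrow>
    inj_on f (verts S) \<and> f ` verts S \<subseteq> {0..card (A \<union> B) + 1} \<and> f a + f b = 1 \<and>
    (\<lambda>x. \<bar>int (f a) - int (f x)\<bar>) ` A \<union> (\<lambda>x. \<bar>int (f b) - int (f x)\<bar>) ` B
      = {1..int (card (A \<union> B))}"
proof -
  have N: "neg_edges S = {{a, b}}"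
    and P: "pos_edges S = (\<lambda>x. {a, x}) ` A \<union> (\<lambda>x. {b, x}) ` B"
    using S by (simp_all add: neg_edge_double_star_def)
  have "{f u + f v | u v. {u, v} \<in> neg_edges S} = {f a + f b}"
    unfolding N by (auto simp: doubleton_eq_iff)
  moreover have "{\<bar>int (f u) - int (f v)\<bar> | u v. {u, v} \<in> pos_edges S}
    = (\<lambda>x. \<bar>int (f a) - int (f x)\<bar>) ` A \<union> (\<lambda>x. \<bar>int (f b) - int (f x)\<bar>) ` B"
    unfolding P by (auto simp: doubleton_eq_iff abs_minus_commute; blast)
  moreover have "card (neg_edges S) = 1"
    by (simp add: N)
  ultimately show ?thesis
    unfolding additively_graceful_labeling_def Let_def card_pos_edges_double_star[OF S] by simp
qed

text \<open>The sums over \<open>P\<close> of both functions equal \<open>\<Sum>T\<close>, so pointwise domination leaves no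
  room for a strict inequality.\<close>

lemma bij_betw_le_imp_eq:
  fixes g h :: "'a \<Rightarrow> int"
  assumes "finite P" "bij_betw h P T" "bij_betw g P T" "\<And>x. x \<in> P \<Longrightarrow> h x \<le> g x" "x \<in> P"
  shows "h x = g x"
proof -
  have "sum h P = sum g P"
    using sum.reindex_bij_betw[OF assms(2), of "\<lambda>t. t"] sum.reindex_bij_betw[OF assms(3), of "\<lambda>t. t"]
    by simp
  then show ?thesis
    using sum_mono_inv[of h P g x] assms by blast
qed

text \<open>A pendant vertex labelled \<open>x\<close> at the end labelled \<open>0\<close> would have the edge label \<open>x\<close>, in
  excess of the \<open>x - 1\<close> that domination allows.\<close>

lemma no_pendants_at_label_0:
  assumes S: "neg_edge_double_star S a b A B"
    and f: "additively_graceful_labeling S f"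
    and ab: "f a = 0" "f b = 1"
  shows "A = {}"
proof -
  let ?P = "A \<union> B" and ?m = "card (A \<union> B)"
  let ?g = "\<lambda>x. if x \<in> A then int (f x) else int (f x) - 1"
  let ?h = "\<lambda>x. int (f x) - 1"
  have fin: "finite ?P" and disj: "A \<inter> B = {}" and ends: "{a, b} \<inter> ?P = {}"
    and V: "verts S = {a, b} \<union> ?P"
    using S by (simp_all add: neg_edge_double_star_def)
  have inj: "inj_on f (verts S)" and range: "f ` verts S \<subseteq> {0..?m + 1}"
    and edges: "(\<lambda>x. \<bar>int (f a) - int (f x)\<bar>) ` A \<union> (\<lambda>x. \<bar>int (f b) - int (f x)\<bar>) ` B
      = {1..int ?m}"
    using f additively_graceful_labeling_double_star[OF S, of f] by blast+
  have ge2: "f x \<ge> 2" if "x \<in> ?P" for x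
  proof -
    have "f x \<noteq> f a" "f x \<noteq> f b"
      using that ends inj_on_contraD[OF inj, of x a] inj_on_contraD[OF inj, of x b]
      unfolding V by blast+
    then show ?thesis using ab by simp
  qed
  have "?h ` ?P \<subseteq> {1..int ?m}"
  proof
    fix y assume "y \<in> ?h ` ?P"
    then obtain x where x: "x \<in> ?P" "y = ?h x" by blast
    then have "f x \<le> ?m + 1" using range V by auto
    then show "y \<in> {1..int ?m}" using ge2[OF x(1)] x(2) by simp
  qed
  moreover have "inj_on ?h ?P"
    using inj unfolding V inj_on_def by simp
  ultimately have h: "bij_betw ?h ?P {1..int ?m}"
    unfolding bij_betw_def by (intro conjI card_subset_eq) (simp_all add: card_image)
  have "?g ` ?P = (\<lambda>x. \<bar>int (f a) - int (f x)\<bar>) ` A \<union> (\<lambda>x. \<bar>int (f b) - int (f x)\<bar>) ` B"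
    unfolding image_Un
  proof (rule arg_cong2[of _ _ _ _ "(\<union>)"]; rule image_cong[OF refl])
    show "?g x = \<bar>int (f a) - int (f x)\<bar>" if "x \<in> A" for x
      using that ab by simp
    show "?g x = \<bar>int (f b) - int (f x)\<bar>" if "x \<in> B" for x
      using that ab disj ge2[of x] by auto
  qed
  then have g_image: "?g ` ?P = {1..int ?m}"
    using edges by simp
  \<comment> \<open>There are exactly as many pendant edges as edge labels to be attained.\<close>
  then have "inj_on ?g ?P"
    using fin by (intro eq_card_imp_inj_on) simp_all
  then have g: "bij_betw ?g ?P {1..int ?m}"
    using g_image by (simp add: bij_betw_def)
  have "?h x = ?g x" if "x \<in> ?P" for x
    by (rule bij_betw_le_imp_eq[OF fin h g _ that]) simp
  then show "A = {}" by force
qed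

lemma double_star_without_left_pendants_graceful:
  assumes S: "neg_edge_double_star S a b {} B"
  shows "additively_graceful S"
proof -
  have ab: "a \<noteq> b" "a \<notin> B" "b \<notin> B" and fin: "finite B" and V: "verts S = insert a (insert b B)"
    using S by (auto simp: neg_edge_double_star_def)
  obtain k where k: "bij_betw k B {2..<card B + 2}"
    using finite_same_card_bij[OF fin, of "{2..<card B + 2}"] by auto
  define f where "f = k(a := 0, b := 1)"
  have fab: "f a = 0" "f b = 1"
    using ab by (simp_all add: f_def)
  have f_B: "f x = k x" if "x \<in> B" for x
    using that ab by (auto simp: f_def)
  have fB: "f ` B = {2..<card B + 2}" and injB: "inj_on f B"
    using k f_B by (simp_all add: bij_betw_def inj_on_def)
  have "inj_on f (verts S)"
    unfolding V using injB ab by (simp add: fab fB)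
  moreover have "f ` verts S \<subseteq> {0..card B + 1}"
    unfolding V by (auto simp: fab fB)
  moreover have "(\<lambda>x. \<bar>int (f b) - int (f x)\<bar>) ` B = {1..int (card B)}"
  proof -
    have "(\<lambda>x. \<bar>int (f b) - int (f x)\<bar>) ` B = (\<lambda>y. \<bar>1 - int y\<bar>) ` f ` B"
      by (simp add: image_image fab)
    also have "\<dots> = {1..int (card B)}"
    proof (intro equalityI subsetI)
      fix t assume "t \<in> {1..int (card B)}"
      then show "t \<in> (\<lambda>y. \<bar>1 - int y\<bar>) ` f ` B"
        unfolding fB by (intro image_eqI[of _ _ "nat t + 1"]) auto
    qed (auto simp: fB)
    finally show ?thesis .
  qed
  ultimately have "additively_graceful_labeling S f"
    using additively_graceful_labeling_double_star[OF S, of f] by (simp add: fab)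
  then show ?thesis
    unfolding additively_graceful_def by blast
qed

theorem theorem3p3:
  fixes S :: "'a sgraph" and l r :: nat
  assumes "neg_edge_with_pendants l r S"
  shows "additively_graceful S \<longleftrightarrow> l = 0 \<or> r = 0"
proof -
  obtain a b A B where S: "neg_edge_double_star S a b A B" and card: "card A = l" "card B = r"
    using neg_edge_with_pendants_double_star[OF assms] .
  note S' = neg_edge_double_star_swap[OF S]
  have "finite A" "finite B"
    using S by (simp_all add: neg_edge_double_star_def)
  then have zero: "l = 0 \<longleftrightarrow> A = {}" "r = 0 \<longleftrightarrow> B = {}"
    using card by auto
  show ?thesis
  proof
    assume "additively_graceful S"
    then obtain f where f: "additively_graceful_labeling S f"
      unfolding additively_graceful_def by blast
    then have "f a + f b = 1"
      using additively_graceful_labeling_double_star[OF S, of f] by blast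
    then consider "f a = 0" "f b = 1" | "f b = 0" "f a = 1"
      by linarith
    then show "l = 0 \<or> r = 0"
      unfolding zero
      using no_pendants_at_label_0[OF S f] no_pendants_at_label_0[OF S' f] by cases blast+
  next
    assume "l = 0 \<or> r = 0"
    then consider "A = {}" | "B = {}"
      unfolding zero by blast
    then show "additively_graceful S"
    proof cases
      case 1
      show ?thesis
        by (rule double_star_without_left_pendants_graceful[OF S[unfolded 1]])
    next
      case 2
      show ?thesis
        by (rule double_star_without_left_pendants_graceful[OF S'[unfolded 2]])
    qed
  qed
qed

end
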